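(* Let $k\geq 2$ be an integer. Then the numbers $C_{2^1-1}, C_{2^2-1},\ldots, C_{2^{k-1}-1}$ are pairwise distinct modulo $2^k$, and for every integer $n\geq k-1$ one has $C_{2^n-1}\equiv C_{2^{k-1}-1}\pmod{2^k}$ (i.e. modulo $2^k$ the sequence $(C_{2^n-1})_{n\geq1}$ is constant from rank $k-1$ on).
   Context: $C_n := \frac{(2n)!}{(n+1)!\,n!}$ denotes the $n$-th Catalan number. *)

theory Defs
  imports "HOL-Number_Theory.Number_Theory"
begin

definition catalan :: "nat \<Rightarrow> nat" where
  "catalan n = fact (2 * n) div (fact (n + 1) * fact n)"

text \<open>The division in the definition is exact, so \<^const>\<open>catalan\<close> is the usual quotient.\<close>

lemma catalan_dvd: "(fact (n + 1) * fact n :: nat) dvd fact (2 * n)"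
proof -
  have "Suc n * (2 * n choose Suc n) = (2 * n choose n) * n"
  proof (cases n)
    case (Suc m)
    then have "Suc (n + m) = 2 * n"
      by simp
    with Suc Suc_times_binomial_add[of n m] show ?thesis
      by (simp only: mult.commute)
  qed simp
  then have "Suc n dvd (2 * n choose n) * n"
    by (metis dvd_triv_left)
  moreover have "coprime (Suc n) n"
    by simp
  ultimately have "Suc n dvd (2 * n choose n)"
    using coprime_dvd_mult_left_iff by blast
  then have "fact n * fact n * Suc n dvd fact n * fact n * (2 * n choose n)"
    by (rule mult_dvd_mono[OF dvd_refl])
  moreover have "fact n * fact n * (2 * n choose n) = (fact (2 * n) :: nat)"
    using binomial_fact_lemma[of n "2 * n"] by simp
  ultimately show ?thesis
    by (simp add: algebra_simps)
qed

lemma real_catalan: "real (catalan n) = fact (2 * n) / (fact (n + 1) * fact n)"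
proof -
  have "real (catalan n) = real (fact (2 * n)) / real (fact (n + 1) * fact n)"
    unfolding catalan_def by (rule real_of_nat_div[OF catalan_dvd])
  then show ?thesis
    by (simp only: of_nat_mult of_nat_fact)
qed

end

theory Submission
  imports Defs
begin

text \<open>
  Put \<open>m = 2 ^ n\<close> with \<open>n \<ge> 1\<close>, and let \<open>D m\<close> be the product of the first \<open>m\<close> odd numbers.
  Cancelling powers of two in the factorials gives
  \<open>(2 m - 1) C(m - 1) D(2 m) = (4 m - 1) C(2 m - 1) D(m)\<^sup>2\<close>. The upper half of \<open>D(2 m)\<close>
  consists of the numbers \<open>4 m - i\<close> for odd \<open>i < 2 m\<close>, an even number of factors, so
  \<open>D(2 m) \<equiv> D(m)\<^sup>2\<close> modulo \<open>4 m\<close>. Hence \<open>C(2 m - 1) \<equiv> (1 - 2 m) C(m - 1)\<close> modulo \<open>4 m\<close>;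
  as \<open>C(m - 1)\<close> is odd, consecutive terms of the sequence agree modulo \<open>2 ^ (n + 1)\<close>
  but not modulo \<open>2 ^ (n + 2)\<close>.
\<close>

definition odd_prod :: "nat \<Rightarrow> nat" where
  "odd_prod m = (\<Prod>i<m. 2 * i + 1)"

lemma odd_odd_prod: "odd (odd_prod m)"
  by (induction m) (auto simp: odd_prod_def)

lemma fact_double: "fact (2 * m) = 2 ^ m * fact m * odd_prod m"
  by (induction m) (auto simp: odd_prod_def algebra_simps)

text \<open>Split the factors \<open>2 * m\<close> and \<open>2 * m - 1\<close> off
  \<open>(2 m)!\<close>; the rest is \<open>m! (m - 1)! C(m - 1)\<close>, and \<open>2 * m\<close>
  absorbs \<open>(m - 1)!\<close> into \<open>2 * m!\<close>.\<close>

lemma fact_double_catalan: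
  assumes "m > 0"
  shows "fact (2 * m) = 2 * (2 * m - 1) * (fact m)\<^sup>2 * catalan (m - 1)"
proof -
  obtain j where m: "m = Suc j"
    using assms gr0_implies_Suc by blast
  have "fact (2 * j) = fact (j + 1) * fact j * catalan j"
    unfolding catalan_def using catalan_dvd[of j] by simp
  moreover have "fact (2 * m) = (2 * j + 2) * (2 * j + 1) * fact (2 * j)"
    by (simp add: m algebra_simps)
  ultimately show ?thesis
    by (simp add: m power2_eq_square algebra_simps)
qed

text \<open>Both \<open>(2 m)!\<close> and \<open>(4 m)!\<close> are written in two ways, once
  through \<open>odd_prod\<close> and once through \<open>catalan\<close>; comparing them eliminates
  the factorials.\<close>

lemma catalan_odd_prod:
  assumes "m > 0"
  shows "(2 * m - 1) * catalan (m - 1) * odd_prod (2 * m)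
       = (4 * m - 1) * catalan (2 * m - 1) * (odd_prod m)\<^sup>2"
proof -
  let ?F = "fact m :: nat" and ?G = "fact (2 * m) :: nat"
  let ?c = "(2 * m - 1) * catalan (m - 1)" and ?d = "(4 * m - 1) * catalan (2 * m - 1)"
  have G: "?G = 2 ^ m * ?F * odd_prod m" "?G = 2 * ?F\<^sup>2 * ?c"
    using fact_double[of m] fact_double_catalan[OF assms] by (simp_all only: ac_simps)
  have "fact (2 * (2 * m)) = 2 ^ (2 * m) * ?G * odd_prod (2 * m)"
    by (rule fact_double)
  moreover have "fact (2 * (2 * m)) = 2 * ?G\<^sup>2 * ?d"
    using fact_double_catalan[of "2 * m"] assms by (simp add: ac_simps)
  ultimately have "?G * (2 ^ (2 * m) * odd_prod (2 * m)) = ?G * (2 * ?G * ?d)"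
    by (simp add: power2_eq_square algebra_simps)
  then have "2 ^ (2 * m) * odd_prod (2 * m) = 2 * ?G * ?d"
    by (simp only: mult_cancel_left fact_nonzero) simp
  moreover have sq: "2 ^ (2 * m) = 2 ^ m * (2 ^ m :: nat)"
    by (simp add: mult_2 power_add)
  ultimately have "2 ^ m * (2 ^ m * odd_prod (2 * m)) = 2 ^ m * (2 * ?F * odd_prod m * ?d)"
    unfolding G(1) sq by (simp only: ac_simps)
  then have half: "2 ^ m * odd_prod (2 * m) = 2 * ?F * odd_prod m * ?d"
    by simp
  \<comment> \<open>The extra factor \<open>2 * ?F\<^sup>2\<close> turns \<open>?c\<close> into
    \<open>?G\<close>, which is then rewritten through \<open>odd_prod m\<close>; it cancels at the
    end.\<close>
  have "2 * ?F\<^sup>2 * (?c * odd_prod (2 * m)) = ?F * odd_prod m * (2 ^ m * odd_prod (2 * m))"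
    using G by (simp add: ac_simps)
  also have "\<dots> = 2 * ?F\<^sup>2 * (?d * (odd_prod m)\<^sup>2)"
    unfolding half by (simp add: power2_eq_square ac_simps)
  finally show ?thesis
    by simp
qed

lemma odd_prod_double_cong:
  assumes "even m"
  shows "[int (odd_prod (2 * m)) = (int (odd_prod m))\<^sup>2] (mod 4 * int m)"
proof -
  let ?g = "\<lambda>i. 2 * int i + 1"
  have D: "int (odd_prod l) = (\<Prod>i<l. ?g i)" for l
    by (simp add: odd_prod_def add.commute)
  have "(\<Prod>i<2 * m. ?g i) = (\<Prod>i<m. ?g i) * (\<Prod>i\<in>{m..<2 * m}. ?g i)"
    by (subst prod.union_disjoint [symmetric]) (auto intro!: prod.cong)
  \<comment> \<open>The reflection sending \<open>i\<close> to \<open>2 * m - 1 - i\<close> swaps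
    the two halves, and reflected factors add up to \<open>4 * m\<close>.\<close>
  also have "(\<Prod>i\<in>{m..<2 * m}. ?g i) = (\<Prod>i<m. 4 * int m - ?g i)"
    by (rule prod.reindex_bij_witness[of _ "\<lambda>i. 2 * m - 1 - i" "\<lambda>i. 2 * m - 1 - i"])
      (auto simp: of_nat_diff)
  finally have "int (odd_prod (2 * m)) = int (odd_prod m) * (\<Prod>i<m. 4 * int m - ?g i)"
    by (simp only: D)
  moreover have "[(\<Prod>i<m. 4 * int m - ?g i) = (\<Prod>i<m. - ?g i)] (mod 4 * int m)"
    by (intro cong_prod) (simp add: cong_iff_dvd_diff)
  \<comment> \<open>The sign is \<open>(-1) ^ m\<close>, which is 1 because \<open>m\<close> is
    even.\<close>
  moreover have "(\<Prod>i<m. - ?g i) = int (odd_prod m)"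
    unfolding D prod_uminus using assms by simp
  ultimately show ?thesis
    by (metis cong_scalar_left power2_eq_square)
qed

lemma catalan_double_cong:
  assumes "n \<ge> 1"
  shows "[int (catalan (2 ^ Suc n - 1)) = (1 - 2 ^ Suc n) * int (catalan (2 ^ n - 1))]
           (mod 2 ^ (n + 2))"
proof -
  define m :: nat where "m = 2 ^ n"
  let ?c = "int (catalan (m - 1))" and ?d = "int (catalan (2 * m - 1))"
  let ?D = "(int (odd_prod m))\<^sup>2" and ?M = "4 * int m"
  have m: "m > 0" "even m"
    using assms by (auto simp: m_def)
  have "int ((2 * m - 1) * catalan (m - 1) * odd_prod (2 * m))
      = int ((4 * m - 1) * catalan (2 * m - 1) * (odd_prod m)\<^sup>2)"
    using catalan_odd_prod[OF m(1)] by simp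
  then have "(2 * int m - 1) * ?c * int (odd_prod (2 * m)) = (?M - 1) * ?d * ?D"
    using m(1) by (simp add: of_nat_diff)
  then have "[(?M - 1) * ?d * ?D = (2 * int m - 1) * ?c * ?D] (mod ?M)"
    by (metis cong_scalar_left cong_sym odd_prod_double_cong[OF m(2)])
  \<comment> \<open>\<open>?D\<close> is odd and \<open>?M\<close> is the power of two
    \<open>2 ^ (n + 2)\<close>, so \<open>?D\<close> may be cancelled.\<close>
  moreover have "coprime ?D ?M"
  proof -
    have "coprime (int (odd_prod m)) (2 ^ (n + 2))"
      using odd_odd_prod[of m] by (simp only: coprime_power_right_iff) simp
    then show ?thesis
      by (simp add: m_def)
  qed
  ultimately have "[(?M - 1) * ?d = (2 * int m - 1) * ?c] (mod ?M)"
    using cong_mult_rcancel by blast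
  \<comment> \<open>Adding \<open>?M * ?d\<close> replaces the coefficient \<open>?M - 1\<close> of
    \<open>?d\<close> by -1.\<close>
  then have "?M dvd ?M * ?d - ((?M - 1) * ?d - (2 * int m - 1) * ?c)"
    by (simp add: cong_iff_dvd_diff)
  then have "[?d = (1 - 2 * int m) * ?c] (mod ?M)"
    by (simp add: cong_iff_dvd_diff algebra_simps)
  then show ?thesis
    by (simp add: m_def)
qed

text \<open>The multiplier \<open>1 - 2 ^ Suc n\<close> is odd, so every term inherits the parity of
  \<open>C(1) = 1\<close>.\<close>

lemma odd_catalan_pow2:
  assumes "n \<ge> 1"
  shows "odd (catalan (2 ^ n - 1))"
  using assms
proof (induction n rule: dec_induct)
  case base
  show ?case
    by (simp add: catalan_def numeral_2_eq_2)
next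
  case (step n)
  have "[int (catalan (2 ^ Suc n - 1)) = (1 - 2 ^ Suc n) * int (catalan (2 ^ n - 1))] (mod 2)"
    using catalan_double_cong[OF step.hyps(1)] by (rule cong_dvd_modulus) simp
  then have "even (int (catalan (2 ^ Suc n - 1)))
      \<longleftrightarrow> even ((1 - 2 ^ Suc n) * int (catalan (2 ^ n - 1)))"
    by (rule cong_dvd_iff)
  with step.IH show ?case
    by simp
qed

lemma catalan_pow2_cong_Suc:
  assumes "n \<ge> 1"
  shows "[catalan (2 ^ Suc n - 1) = catalan (2 ^ n - 1)] (mod 2 ^ Suc n)"
proof -
  have "[int (catalan (2 ^ Suc n - 1)) = (1 - 2 ^ Suc n) * int (catalan (2 ^ n - 1))]
      (mod 2 ^ Suc n)"
    using catalan_double_cong[OF assms] by (rule cong_dvd_modulus) simp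
  also have "[(1 - 2 ^ Suc n) * int (catalan (2 ^ n - 1)) = int (catalan (2 ^ n - 1))]
      (mod 2 ^ Suc n)"
    by (simp add: cong_iff_dvd_diff algebra_simps)
  finally have "[int (catalan (2 ^ Suc n - 1)) = int (catalan (2 ^ n - 1))]
      (mod int (2 ^ Suc n))"
    by simp
  then show ?thesis
    by (simp only: cong_int_iff)
qed

text \<open>The difference is \<open>- (2 ^ Suc n) * C(2 ^ n - 1)\<close> modulo
  \<open>2 ^ (n + 2)\<close>, and it could vanish only if \<open>C(2 ^ n - 1)\<close> were
  even.\<close>

lemma catalan_pow2_not_cong_Suc:
  assumes "n \<ge> 1"
  shows "\<not> [catalan (2 ^ Suc n - 1) = catalan (2 ^ n - 1)] (mod 2 ^ (n + 2))"
proof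
  let ?c = "int (catalan (2 ^ n - 1))"
  assume "[catalan (2 ^ Suc n - 1) = catalan (2 ^ n - 1)] (mod 2 ^ (n + 2))"
  then have "[int (catalan (2 ^ Suc n - 1)) = ?c] (mod int (2 ^ (n + 2)))"
    by (simp only: cong_int_iff)
  then have "[?c = (1 - 2 ^ Suc n) * ?c] (mod 2 ^ (n + 2))"
    using catalan_double_cong[OF assms] by (simp add: cong_def)
  then have "2 ^ Suc n * 2 dvd 2 ^ Suc n * ?c"
    by (simp add: cong_iff_dvd_diff algebra_simps)
  then have "even ?c"
    by (simp only: dvd_mult_cancel_left) simp
  with odd_catalan_pow2[OF assms] show False
    by simp
qed

text \<open>The steps telescope: each step from rank \<open>i\<close> on is a congruence modulo a
  multiple of \<open>2 ^ Suc i\<close>.\<close>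

lemma catalan_pow2_cong:
  assumes "i \<ge> 1" "i \<le> n"
  shows "[catalan (2 ^ n - 1) = catalan (2 ^ i - 1)] (mod 2 ^ Suc i)"
  using assms(2)
proof (induction n rule: dec_induct)
  case base
  show ?case
    by simp
next
  case (step n)
  have "[catalan (2 ^ Suc n - 1) = catalan (2 ^ n - 1)] (mod 2 ^ Suc n)"
    using assms(1) step.hyps by (intro catalan_pow2_cong_Suc) simp
  then have "[catalan (2 ^ Suc n - 1) = catalan (2 ^ n - 1)] (mod 2 ^ Suc i)"
    by (rule cong_dvd_modulus_nat) (use step.hyps in \<open>simp add: le_imp_power_dvd\<close>)
  then show ?case
    using step.IH cong_trans by blast
qed

text \<open>Modulo \<open>2 ^ (i + 2)\<close> the term of rank \<open>j\<close> agrees with that of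
  rank \<open>i + 1\<close>, which already differs from that of rank \<open>i\<close>.\<close>

lemma catalan_pow2_not_cong:
  assumes "i \<ge> 1" "i < j"
  shows "\<not> [catalan (2 ^ j - 1) = catalan (2 ^ i - 1)] (mod 2 ^ (i + 2))"
  using catalan_pow2_cong[of "Suc i" j] catalan_pow2_not_cong_Suc[of i] assms
  by (auto simp: cong_def)

theorem theorem1p2:
  fixes k :: nat
  assumes "k \<ge> 2"
  shows "(\<forall>i\<in>{1..k - 1}. \<forall>j\<in>{1..k - 1}. i \<noteq> j \<longrightarrow>
            \<not> [catalan (2 ^ i - 1) = catalan (2 ^ j - 1)] (mod 2 ^ k))
       \<and> (\<forall>n::nat. n \<ge> k - 1 \<longrightarrow>
            [catalan (2 ^ n - 1) = catalan (2 ^ (k - 1) - 1)] (mod 2 ^ k))"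
proof -
  have *: "\<not> [catalan (2 ^ j - 1) = catalan (2 ^ i - 1)] (mod 2 ^ k)"
    if "1 \<le> i" "i < j" "j \<le> k - 1" for i j
  proof
    assume "[catalan (2 ^ j - 1) = catalan (2 ^ i - 1)] (mod 2 ^ k)"
    \<comment> \<open>From \<open>i < j\<close> and \<open>j \<le> k - 1\<close> follows
      \<open>i + 2 \<le> k\<close>, so the modulus may be lowered.\<close>
    then have "[catalan (2 ^ j - 1) = catalan (2 ^ i - 1)] (mod 2 ^ (i + 2))"
      by (rule cong_dvd_modulus_nat) (use that in \<open>simp add: le_imp_power_dvd del: power_Suc\<close>)
    with catalan_pow2_not_cong[OF that(1,2)] show False
      by simp
  qed
  have "\<not> [catalan (2 ^ i - 1) = catalan (2 ^ j - 1)] (mod 2 ^ k)"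
    if "i \<in> {1..k - 1}" "j \<in> {1..k - 1}" "i \<noteq> j" for i j
    using *[of i j] *[of j i] that cong_sym[of "catalan (2 ^ i - 1)" "catalan (2 ^ j - 1)"]
    by (cases "i < j") auto
  moreover have "[catalan (2 ^ n - 1) = catalan (2 ^ (k - 1) - 1)] (mod 2 ^ k)"
    if "n \<ge> k - 1" for n
    using catalan_pow2_cong[of "k - 1" n] that assms by simp
  ultimately show ?thesis
    by blast
qed

end
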